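(* Let $n,d\ge 1$ and let $S$ be a finite $d$-independent set of points in $\mathbb{R}^n$. Then the face $Pos_{n,2d}(S)$ is full dimensional in the vector space $I_{2,2d}(S)$; that is, the linear span of the convex cone $Pos_{n,2d}(S)\subseteq I_{2,2d}(S)$ is all of $I_{2,2d}(S)$.
   Context: $P_{n,m}$ denotes the real vector space of forms (homogeneous polynomials) in $n$ variables of degree $m$ with real coefficients. $Pos_{n,2d}=\{p\in P_{n,2d} : p(x)\ge 0 \text{ for all } x\in\mathbb{R}^n\}$. Finite sets $S\subset\mathbb{R}^n$ consist of nonzero vectors and are thought of projectively, i.e. as sets of distinct points of $\mathbb{RP}^{n-1}$. Define $$Pos_{n,2d}(S)=\{p\in Pos_{n,2d} : p(s)=0\ \forall s\in S\},\qquad I_{1,d}(S)=\{p\in P_{n,d} : p(s)=0\ \forall s\in S\},$$ $$I_{2,2d}(S)=\left\{p\in P_{n,2d} : \tfrac{\partial p}{\partial x_i}(s)=0\ \forall s\in S,\ i=1,\dots,n\right\}.$$ A form vanishes to order 2 (double vanishes) at $s$ if all its first partial derivatives vanish at $s$ (for forms of positive degree this implies that the form vanishes at $s$). A finite set $S$ is called $d$-independent if: (1) $S$ forces no additional zeroes for forms of degree $d$ that vanish on $S$, i.e. the set of common zeroes in $\mathbb{RP}^{n-1}$ of the forms in $I_{1,d}(S)$ is exactly $S$; and (2) for every $s\in S$, the forms in $P_{n,d}$ that vanish to order 2 at $s$ and vanish on the rest of $S$ form a vector subspace of codimension $|S|+n-1$ in $P_{n,d}$. *)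

theory Defs
  imports "HOL-Analysis.Analysis" "HOL-Library.Poly_Mapping"
begin

instantiation poly_mapping :: (type, real_vector) real_vector
begin

definition scaleR_poly_mapping :: "real \<Rightarrow> ('a \<Rightarrow>\<^sub>0 'b) \<Rightarrow> ('a \<Rightarrow>\<^sub>0 'b)" where
  "scaleR_poly_mapping c p = Poly_Mapping.map (\<lambda>a. c *\<^sub>R a) p"

lemma lookup_scaleR: "Poly_Mapping.lookup (c *\<^sub>R p) k = c *\<^sub>R Poly_Mapping.lookup p k"
  for p :: "'a \<Rightarrow>\<^sub>0 'b"
  by (simp add: scaleR_poly_mapping_def Poly_Mapping.map.rep_eq when_def)

instance
  by standard
    (auto intro!: poly_mapping_eqI
       simp: lookup_scaleR lookup_add scaleR_add_left scaleR_add_right)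

end

text \<open>
  Real polynomials in variables indexed by the finite type \<open>'n\<close> (so \<open>n = CARD('n) \<ge> 1\<close>):
  finitely supported maps from exponent vectors to coefficients.
\<close>

type_synonym 'n real_mpoly = "('n \<Rightarrow>\<^sub>0 nat) \<Rightarrow>\<^sub>0 real"

definition poly_eval :: "'n::finite real_mpoly \<Rightarrow> real ^ 'n \<Rightarrow> real" where
  "poly_eval p x =
     (\<Sum>\<alpha>\<in>Poly_Mapping.keys p.
        Poly_Mapping.lookup p \<alpha> * (\<Prod>i\<in>UNIV. (x $ i) ^ Poly_Mapping.lookup \<alpha> i))"

definition forms :: "nat \<Rightarrow> 'n::finite real_mpoly set" where
  "forms m =
     {p. \<forall>\<alpha>\<in>Poly_Mapping.keys p. (\<Sum>i\<in>UNIV. Poly_Mapping.lookup \<alpha> i) = m}"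

definition partial_deriv_at :: "'n::finite real_mpoly \<Rightarrow> 'n \<Rightarrow> real ^ 'n \<Rightarrow> real" where
  "partial_deriv_at p i x = frechet_derivative (poly_eval p) (at x) (axis i 1)"

text \<open>\<open>frechet_derivative\<close> is only meaningful where the function is differentiable.\<close>

lemma poly_eval_differentiable:
  fixes p :: "'n::finite real_mpoly"
  shows "poly_eval p differentiable (at x)"
proof -
  have coord: "(\<lambda>x. x $ i) differentiable (at x)" for i and x :: "real ^ 'n"
    by (rule bounded_linear_imp_differentiable) (rule bounded_linear_vec_nth)
  have "(\<lambda>x. \<Prod>i\<in>I. (x $ i) ^ e i) differentiable (at x)"
    if "finite I" for I :: "'n set" and e :: "'n \<Rightarrow> nat" and x :: "real ^ 'n"
    using that
    by induction (auto intro!: differentiable_mult differentiable_power coord)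
  then have "(\<lambda>x. \<Sum>\<alpha>\<in>Poly_Mapping.keys p.
        Poly_Mapping.lookup p \<alpha> * (\<Prod>i\<in>UNIV. (x $ i) ^ Poly_Mapping.lookup \<alpha> i))
      differentiable (at x)"
    by (intro differentiable_sum ballI differentiable_mult) auto
  then show ?thesis
    by (simp add: poly_eval_def [abs_def])
qed

definition double_vanishes :: "'n::finite real_mpoly \<Rightarrow> real ^ 'n \<Rightarrow> bool" where
  "double_vanishes p s \<longleftrightarrow> (\<forall>i. partial_deriv_at p i s = 0)"

definition Pos :: "nat \<Rightarrow> 'n::finite real_mpoly set" where
  "Pos m = {p \<in> forms m. \<forall>x. 0 \<le> poly_eval p x}"

definition Pos_face :: "nat \<Rightarrow> (real ^ 'n::finite) set \<Rightarrow> 'n real_mpoly set" where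
  "Pos_face m S = {p \<in> Pos m. \<forall>s\<in>S. poly_eval p s = 0}"

definition I1 :: "nat \<Rightarrow> (real ^ 'n::finite) set \<Rightarrow> 'n real_mpoly set" where
  "I1 m S = {p \<in> forms m. \<forall>s\<in>S. poly_eval p s = 0}"

definition I2 :: "nat \<Rightarrow> (real ^ 'n::finite) set \<Rightarrow> 'n real_mpoly set" where
  "I2 m S = {p \<in> forms m. \<forall>s\<in>S. double_vanishes p s}"

text \<open>
  Points of real projective space are represented by nonzero vectors up to nonzero scalars.
  A finite set of vectors represents equally many projective points when it avoids 0 and
  its members are pairwise not proportional.
\<close>

definition proj_eq :: "real ^ 'n::finite \<Rightarrow> real ^ 'n \<Rightarrow> bool" where
  "proj_eq x y \<longleftrightarrow> (\<exists>c. c \<noteq> 0 \<and> x = c *\<^sub>R y)"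

definition finite_proj_set :: "(real ^ 'n::finite) set \<Rightarrow> bool" where
  "finite_proj_set S \<longleftrightarrow>
     finite S \<and> 0 \<notin> S \<and> (\<forall>s\<in>S. \<forall>t\<in>S. proj_eq s t \<longrightarrow> s = t)"

text \<open>
  The codimension condition is written additively, as \<open>dim V + codim V = dim (forms d)\<close>,
  to avoid truncated subtraction of dimensions.
\<close>

definition d_independent :: "nat \<Rightarrow> (real ^ 'n::finite) set \<Rightarrow> bool" where
  "d_independent d S \<longleftrightarrow>
     {x. x \<noteq> 0 \<and> (\<forall>p\<in>I1 d S. poly_eval p x = 0)} = {x. \<exists>s\<in>S. proj_eq x s} \<and>
     (\<forall>s\<in>S.
        dim {p \<in> forms d. double_vanishes p s \<and> (\<forall>t\<in>S - {s}. poly_eval p t = 0)}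
          + (card S + CARD('n) - 1)
        = dim (forms d :: 'n real_mpoly set))"

end

theory Submission
  imports Defs
begin

text \<open>
  Differentiating at a zero, where a nonnegative form has a minimum, shows that the cone
  \<open>Pos_face (2 * d) S\<close> lies in the space \<open>I2 (2 * d) S\<close>. For the converse it is enough to
  find one \<open>p\<close> in the cone such that for each \<open>q\<close> in the space some \<open>p + \<epsilon> q\<close> with
  \<open>\<epsilon> > 0\<close> is still nonnegative: then \<open>q\<close> is a multiple of the difference of two members of
  the cone.

  Such a \<open>p\<close> is the sum of the squares of a finite set that spans \<open>I1 d S\<close> (lemma
  \<open>interior_form_exists\<close>). Away from its zeros \<open>p\<close> is positive, and by the first condition
  of \<open>d\<close>-independence the zeros are the lines through the points of \<open>S\<close>. The second
  condition says that the Hessian of \<open>p\<close> at \<open>s \<in> S\<close> is as nondegenerate as homogeneity allows: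
  if the differentials at \<open>s\<close> of all forms in \<open>I1 d S\<close> killed a vector \<open>v\<close> independent of
  \<open>s\<close>, then double vanishing at \<open>s\<close> would cost a form in \<open>I1 d S\<close> only \<open>n - 2\<close> linear
  conditions, since by Euler's identity the direction \<open>s\<close> is free as well; the codimension
  would be at most \<open>card S + n - 2\<close> (lemma \<open>common_tangent_is_radial\<close>). Hence on the
  hyperplane orthogonal to \<open>s\<close> the form \<open>p\<close> grows at least quadratically around \<open>s\<close>,
  whereas \<open>q\<close>, vanishing to second order, grows at most quadratically (lemma
  \<open>sum_squares_dominates_near_zero\<close>). Homogeneity carries this estimate to a neighbourhood of
  the whole line, compactness of the unit sphere makes \<open>\<epsilon>\<close> uniform there, and homogeneity
  once more extends the inequality from the sphere to the whole space.
\<close>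

section \<open>Evaluation as a ring homomorphism\<close>

definition monomial_eval :: "('n::finite \<Rightarrow>\<^sub>0 nat) \<Rightarrow> real ^ 'n \<Rightarrow> real" where
  "monomial_eval \<alpha> x = (\<Prod>i\<in>UNIV. (x $ i) ^ Poly_Mapping.lookup \<alpha> i)"

lemma monomial_eval_add: "monomial_eval (\<alpha> + \<beta>) x = monomial_eval \<alpha> x * monomial_eval \<beta> x"
  by (simp add: monomial_eval_def lookup_add power_add prod.distrib)

lemma monomial_eval_scaleR:
  "monomial_eval \<alpha> (c *\<^sub>R x) = c ^ (\<Sum>i\<in>UNIV. Poly_Mapping.lookup \<alpha> i) * monomial_eval \<alpha> x"
  by (simp add: monomial_eval_def power_mult_distrib prod.distrib power_sum)

lemma poly_eval_eq_sum:
  assumes "finite A" "Poly_Mapping.keys p \<subseteq> A"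
  shows "poly_eval p x = (\<Sum>\<alpha>\<in>A. Poly_Mapping.lookup p \<alpha> * monomial_eval \<alpha> x)"
  unfolding poly_eval_def monomial_eval_def
  using assms by (intro sum.mono_neutral_left) (auto simp: in_keys_iff)

lemma linear_poly_eval: "linear (\<lambda>p. poly_eval p x)"
proof (rule linearI)
  fix p q :: "'a real_mpoly"
  let ?A = "Poly_Mapping.keys p \<union> Poly_Mapping.keys q"
  have *: "poly_eval r x = (\<Sum>\<alpha>\<in>?A. Poly_Mapping.lookup r \<alpha> * monomial_eval \<alpha> x)"
    if "Poly_Mapping.keys r \<subseteq> ?A" for r
    using that by (intro poly_eval_eq_sum) auto
  show "poly_eval (p + q) x = poly_eval p x + poly_eval q x"
    unfolding *[OF keys_add] *[OF Un_upper1] *[OF Un_upper2]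
    by (simp add: lookup_add distrib_right sum.distrib)
next
  fix c and p :: "'a real_mpoly"
  have *: "Poly_Mapping.keys (c *\<^sub>R p) \<subseteq> Poly_Mapping.keys p"
    by (auto simp: in_keys_iff lookup_scaleR)
  show "poly_eval (c *\<^sub>R p) x = c *\<^sub>R poly_eval p x"
    unfolding poly_eval_eq_sum[OF finite_keys *] poly_eval_eq_sum[OF finite_keys order_refl, of p]
    by (simp add: lookup_scaleR sum_distrib_left mult.assoc)
qed

lemmas poly_eval_add = linear_add[OF linear_poly_eval]
lemmas poly_eval_scaleR = linear_scale[OF linear_poly_eval]
lemmas poly_eval_sum = linear_sum[OF linear_poly_eval]

lemma poly_eval_single:
  "poly_eval (Poly_Mapping.single \<alpha> c) x = c * monomial_eval \<alpha> x"
  by (subst poly_eval_eq_sum[where A = "{\<alpha>}"]) auto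

lemma poly_mapping_eq_sum_single:
  "p = (\<Sum>\<alpha>\<in>Poly_Mapping.keys p. Poly_Mapping.single \<alpha> (Poly_Mapping.lookup p \<alpha>))"
  by (rule poly_mapping_eqI)
    (auto simp: lookup_sum lookup_single when_def sum.delta in_keys_iff)

lemma poly_eval_mult: "poly_eval (p * q) x = poly_eval p x * poly_eval q x"
proof -
  have "p * q = (\<Sum>\<alpha>\<in>Poly_Mapping.keys p. \<Sum>\<beta>\<in>Poly_Mapping.keys q.
      Poly_Mapping.single (\<alpha> + \<beta>) (Poly_Mapping.lookup p \<alpha> * Poly_Mapping.lookup q \<beta>))"
    by (subst (1) poly_mapping_eq_sum_single[of p], subst (1) poly_mapping_eq_sum_single[of q])
      (simp add: sum_product mult_single)
  then have "poly_eval (p * q) x = (\<Sum>\<alpha>\<in>Poly_Mapping.keys p. \<Sum>\<beta>\<in>Poly_Mapping.keys q.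
      (Poly_Mapping.lookup p \<alpha> * monomial_eval \<alpha> x)
        * (Poly_Mapping.lookup q \<beta> * monomial_eval \<beta> x))"
    by (simp add: poly_eval_sum poly_eval_single monomial_eval_add mult_ac)
  then show ?thesis
    by (simp add: sum_product[symmetric] poly_eval_eq_sum[OF finite_keys order_refl])
qed

lemma real_polynomial_function_poly_eval: "real_polynomial_function (poly_eval p)"
proof -
  have "real_polynomial_function (\<lambda>x::real^'a. \<Prod>i\<in>I. (x $ i) ^ e i)" if "finite I" for I e
    using that
    by (intro real_polynomial_function_prod real_polynomial_function_power)
      (auto intro: real_polynomial_function.intros(1) bounded_linear_vec_nth)
  then show ?thesis
    unfolding poly_eval_def[abs_def]
    by (intro real_polynomial_function_sum real_polynomial_function.intros(2,4)) auto
qed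

lemma continuous_on_poly_eval: "continuous_on A (poly_eval p)"
  by (intro differentiable_imp_continuous_on)
    (simp add: differentiable_on_def differentiable_at_withinI poly_eval_differentiable)

section \<open>Spaces of forms\<close>

lemma subspace_forms: "subspace (forms m)"
  using keys_add
  by (fastforce simp: forms_def subspace_def in_keys_iff lookup_scaleR)

lemma forms_mult: "p \<in> forms a \<Longrightarrow> q \<in> forms b \<Longrightarrow> p * q \<in> forms (a + b)"
  using keys_mult[of p q] by (fastforce simp: forms_def lookup_add sum.distrib)

lemma poly_eval_homogeneous:
  assumes "p \<in> forms m"
  shows "poly_eval p (c *\<^sub>R x) = c ^ m * poly_eval p x"
  using assms
  by (simp add: poly_eval_eq_sum[OF finite_keys order_refl] monomial_eval_scaleR forms_def
      sum_distrib_left mult_ac)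

text \<open>
  Each exponent of a monomial of degree \<open>m\<close> is at most \<open>m\<close>, so there are finitely many such
  monomials. The ambient space of all polynomials has infinite dimension, which is why the
  dimension arguments below carry a finite spanning set \<open>T\<close> along.
\<close>

lemma forms_finite_dimensional:
  obtains T :: "'n::finite real_mpoly set" where "finite T" "forms m \<subseteq> span T"
proof
  let ?E = "{\<alpha> :: 'n \<Rightarrow>\<^sub>0 nat. (\<Sum>i\<in>UNIV. Poly_Mapping.lookup \<alpha> i) = m}"
  let ?T = "(\<lambda>\<alpha>. Poly_Mapping.single \<alpha> (1::real)) ` ?E"
  have "Poly_Mapping.lookup \<alpha> i \<le> (\<Sum>i\<in>UNIV. Poly_Mapping.lookup \<alpha> i)" for \<alpha> :: "'n \<Rightarrow>\<^sub>0 nat" and i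
    by (rule member_le_sum) auto
  then have "Poly_Mapping.lookup ` ?E \<subseteq> PiE UNIV (\<lambda>_. {..m})"
    by auto
  then have "finite (Poly_Mapping.lookup ` ?E)"
    by (rule finite_subset) (auto intro!: finite_PiE)
  then have "finite ?E"
    by (rule finite_imageD) (simp add: inj_on_def poly_mapping_eqI)
  then show "finite ?T" by simp
  show "forms m \<subseteq> span ?T"
  proof
    fix p :: "'n real_mpoly" assume p: "p \<in> forms m"
    have *: "Poly_Mapping.single \<alpha> c = c *\<^sub>R Poly_Mapping.single \<alpha> 1" for \<alpha> :: "'n \<Rightarrow>\<^sub>0 nat" and c :: real
      by (rule poly_mapping_eqI) (simp add: lookup_scaleR lookup_single when_def)
    have "Poly_Mapping.single \<alpha> c \<in> span ?T" if "\<alpha> \<in> Poly_Mapping.keys p" for \<alpha> c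
      using p that by (subst *, intro span_scale span_base imageI) (simp add: forms_def)
    then have "(\<Sum>\<alpha>\<in>Poly_Mapping.keys p. Poly_Mapping.single \<alpha> (Poly_Mapping.lookup p \<alpha>)) \<in> span ?T"
      by (intro span_sum)
    then show "p \<in> span ?T"
      using poly_mapping_eq_sum_single[of p] by simp
  qed
qed

section \<open>The differential of a form\<close>

abbreviation differential :: "'n::finite real_mpoly \<Rightarrow> real ^ 'n \<Rightarrow> real ^ 'n \<Rightarrow> real" where
  "differential p s \<equiv> frechet_derivative (poly_eval p) (at s)"

lemma has_derivative_differential: "(poly_eval p has_derivative differential p s) (at s)"
  using frechet_derivative_works poly_eval_differentiable by blast

lemma linear_differential: "linear (differential p s)"
  using has_derivative_differential has_derivative_linear by blast

lemma linear_differential_form: "linear (\<lambda>p. differential p s v)"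
proof (rule linearI)
  fix p q :: "'a real_mpoly"
  have "poly_eval (p + q) = (\<lambda>x. poly_eval p x + poly_eval q x)"
    by (rule ext) (rule poly_eval_add)
  moreover have "((\<lambda>x. poly_eval p x + poly_eval q x) has_derivative
      (\<lambda>v. differential p s v + differential q s v)) (at s)"
    by (intro has_derivative_add has_derivative_differential)
  ultimately show "differential (p + q) s v = differential p s v + differential q s v"
    by (simp only: frechet_derivative_at[symmetric])
next
  fix c and p :: "'a real_mpoly"
  have "poly_eval (c *\<^sub>R p) = (\<lambda>x. c *\<^sub>R poly_eval p x)"
    by (rule ext) (rule poly_eval_scaleR)
  moreover have "((\<lambda>x. c *\<^sub>R poly_eval p x) has_derivative (\<lambda>v. c *\<^sub>R differential p s v)) (at s)"
    by (intro has_derivative_scaleR_right has_derivative_differential)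
  ultimately show "differential (c *\<^sub>R p) s v = c *\<^sub>R differential p s v"
    by (simp only: frechet_derivative_at[symmetric])
qed

text \<open>Differentiate \<open>t \<mapsto> p(ts) = t\<^sup>m p(s)\<close> at \<open>t = 1\<close>.\<close>

lemma Euler_identity:
  assumes "p \<in> forms m"
  shows "differential p s s = m * poly_eval p s"
proof -
  have "((\<lambda>t. t *\<^sub>R s) has_derivative (\<lambda>h. h *\<^sub>R s)) (at 1)"
    by (auto intro!: derivative_eq_intros)
  moreover have "(poly_eval p has_derivative differential p s) (at (1 *\<^sub>R s))"
    by (simp add: has_derivative_differential)
  ultimately have "((\<lambda>t. poly_eval p (t *\<^sub>R s)) has_derivative (\<lambda>h. differential p s (h *\<^sub>R s))) (at 1)"
    by (rule has_derivative_compose)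
  moreover have "((\<lambda>t. poly_eval p (t *\<^sub>R s)) has_derivative (\<lambda>h. h * (m * poly_eval p s))) (at 1)"
    unfolding poly_eval_homogeneous[OF assms]
    by (auto intro!: derivative_eq_intros)
  ultimately have "(\<lambda>h. differential p s (h *\<^sub>R s)) = (\<lambda>h. h * (m * poly_eval p s))"
    by (rule has_derivative_unique)
  then show ?thesis by (metis mult_1 scaleR_one)
qed

text \<open>
  The coordinate directions may be replaced by any spanning set, in particular by a basis
  adapted to the point \<open>s\<close>.
\<close>

lemma double_vanishes_iff_on_spanning_set:
  assumes "span B = UNIV"
  shows "double_vanishes p s \<longleftrightarrow> (\<forall>w\<in>B. differential p s w = 0)"
proof
  assume "double_vanishes p s"
  then have "differential p s b = 0" if "b \<in> Basis" for b
    using that by (auto simp: double_vanishes_def partial_deriv_at_def Basis_vec_def)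
  then have "differential p s w = 0" for w
    using linear_eq_0_on_span[OF linear_differential, of Basis p s w] by simp
  then show "\<forall>w\<in>B. differential p s w = 0" by simp
next
  assume "\<forall>w\<in>B. differential p s w = 0"
  then have "differential p s w = 0" for w
    using linear_eq_0_on_span[OF linear_differential, of B p s w] assms by simp
  then show "double_vanishes p s"
    by (simp add: double_vanishes_def partial_deriv_at_def)
qed

lemma double_vanishes_iff: "double_vanishes p s \<longleftrightarrow> (\<forall>w. differential p s w = 0)"
  using double_vanishes_iff_on_spanning_set[of UNIV] by simp

lemma double_vanishes_imp_vanishes:
  assumes "p \<in> forms m" "1 \<le> m" "double_vanishes p s"
  shows "poly_eval p s = 0"
  using assms Euler_identity[OF assms(1), of s] by (simp add: double_vanishes_iff)

lemma subspace_I1: "subspace (I1 m S)"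
  using subspace_forms[of m]
  by (auto simp: I1_def subspace_def poly_eval_add poly_eval_scaleR linear_0[OF linear_poly_eval])

lemma subspace_I2: "subspace (I2 m S)"
  using subspace_forms[of m]
  by (auto simp: I2_def subspace_def double_vanishes_iff
      linear_add[OF linear_differential_form] linear_scale[OF linear_differential_form]
      linear_0[OF linear_differential_form])

text \<open>
  A quadratic remainder bound is inherited by sums and products, so structural induction
  replaces any discussion of second derivatives.
\<close>

lemma quadratic_taylor_bound:
  assumes "real_polynomial_function f"
  shows "\<exists>f' C. (f has_derivative f') (at s) \<and> 0 \<le> C \<and>
      (\<forall>v. norm v \<le> 1 \<longrightarrow> \<bar>f (s + v) - f s - f' v\<bar> \<le> C * (norm v)\<^sup>2)"
  using assms
proof induction
  case (linear f)
  then show ?case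
    by (intro exI[of _ f] exI[of _ 0])
      (simp add: bounded_linear_imp_has_derivative linear_simps)
next
  case (const c)
  then show ?case
    by (intro exI[of _ "\<lambda>_. 0"] exI[of _ 0]) simp
next
  case (add f g)
  then obtain f' C g' D where
    f: "(f has_derivative f') (at s)" "0 \<le> C"
      "\<And>v. norm v \<le> 1 \<Longrightarrow> \<bar>f (s + v) - f s - f' v\<bar> \<le> C * (norm v)\<^sup>2" and
    g: "(g has_derivative g') (at s)" "0 \<le> D"
      "\<And>v. norm v \<le> 1 \<Longrightarrow> \<bar>g (s + v) - g s - g' v\<bar> \<le> D * (norm v)\<^sup>2"
    by (elim exE conjE) (rule that; blast)
  show ?case
  proof (intro exI[of _ "\<lambda>v. f' v + g' v"] exI[of _ "C + D"] conjI allI impI)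
    show "((\<lambda>x. f x + g x) has_derivative (\<lambda>v. f' v + g' v)) (at s)"
      using f g by (intro has_derivative_add)
    fix v :: 'a assume "norm v \<le> 1"
    then show "\<bar>f (s + v) + g (s + v) - (f s + g s) - (f' v + g' v)\<bar> \<le> (C + D) * (norm v)\<^sup>2"
      using f(3)[of v] g(3)[of v] by (simp add: distrib_right)
  qed (use f g in simp)
next
  case (mult f g)
  then obtain f' C g' D where
    f: "(f has_derivative f') (at s)" "0 \<le> C"
      "\<And>v. norm v \<le> 1 \<Longrightarrow> \<bar>f (s + v) - f s - f' v\<bar> \<le> C * (norm v)\<^sup>2" and
    g: "(g has_derivative g') (at s)" "0 \<le> D"
      "\<And>v. norm v \<le> 1 \<Longrightarrow> \<bar>g (s + v) - g s - g' v\<bar> \<le> D * (norm v)\<^sup>2"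
    by (elim exE conjE) (rule that; blast)
  obtain K where K: "0 \<le> K" "\<And>v. \<bar>f' v\<bar> \<le> K * norm v"
    using bounded_linear.nonneg_bounded[OF has_derivative_bounded_linear[OF f(1)]]
    by (auto simp: mult.commute)
  obtain L where L: "0 \<le> L" "\<And>v. \<bar>g' v\<bar> \<le> L * norm v"
    using bounded_linear.nonneg_bounded[OF has_derivative_bounded_linear[OF g(1)]]
    by (auto simp: mult.commute)
  let ?E = "K * L + C * (\<bar>g s\<bar> + L + D) + D * (\<bar>f s\<bar> + K)"
  show ?case
  proof (intro exI[of _ "\<lambda>v. f s * g' v + f' v * g s"] exI[of _ ?E] conjI allI impI)
    show "((\<lambda>x. f x * g x) has_derivative (\<lambda>v. f s * g' v + f' v * g s)) (at s)"
      using f g by (intro has_derivative_mult)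
    show "0 \<le> ?E" using f g K L by simp
    fix v :: 'a assume v: "norm v \<le> 1"
    then have v2: "(norm v)\<^sup>2 \<le> 1" by (simp add: power_le_one)
    define R where "R = f (s + v) - f s - f' v"
    define T where "T = g (s + v) - g s - g' v"
    have R: "\<bar>R\<bar> \<le> C * (norm v)\<^sup>2" and T: "\<bar>T\<bar> \<le> D * (norm v)\<^sup>2"
      using f(3) g(3) v by (auto simp: R_def T_def)
    have f'1: "\<bar>f' v\<bar> \<le> K"
      using K(2)[of v] mult_left_mono[OF v K(1)] by simp
    have g'1: "\<bar>g' v\<bar> \<le> L"
      using L(2)[of v] mult_left_mono[OF v L(1)] by simp
    have T1: "\<bar>T\<bar> \<le> D" using T mult_left_mono[OF v2 g(2)] by simp
    have a: "\<bar>f' v * g' v\<bar> \<le> K * L * (norm v)\<^sup>2"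
      using mult_mono[OF K(2)[of v] L(2)[of v]] K(1)
      by (simp add: abs_mult power2_eq_square mult_ac)
    have "\<bar>g s + g' v + T\<bar> \<le> \<bar>g s\<bar> + L + D" using g'1 T1 by linarith
    then have b: "\<bar>R * (g s + g' v + T)\<bar> \<le> (C * (norm v)\<^sup>2) * (\<bar>g s\<bar> + L + D)"
      unfolding abs_mult using R f(2) by (intro mult_mono) auto
    have "\<bar>f s + f' v\<bar> \<le> \<bar>f s\<bar> + K" using f'1 by linarith
    then have c: "\<bar>T * (f s + f' v)\<bar> \<le> (D * (norm v)\<^sup>2) * (\<bar>f s\<bar> + K)"
      unfolding abs_mult using T g(2) by (intro mult_mono) auto
    have "f (s + v) * g (s + v) - f s * g s - (f s * g' v + f' v * g s)
        = f' v * g' v + R * (g s + g' v + T) + T * (f s + f' v)"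
      by (simp add: R_def T_def algebra_simps)
    then have "\<bar>f (s + v) * g (s + v) - f s * g s - (f s * g' v + f' v * g s)\<bar>
        \<le> K * L * (norm v)\<^sup>2 + (C * (norm v)\<^sup>2) * (\<bar>g s\<bar> + L + D) + (D * (norm v)\<^sup>2) * (\<bar>f s\<bar> + K)"
      using a b c by linarith
    then show "\<bar>f (s + v) * g (s + v) - f s * g s - (f s * g' v + f' v * g s)\<bar> \<le> ?E * (norm v)\<^sup>2"
      by (simp add: algebra_simps)
  qed
qed

lemma poly_eval_taylor:
  obtains C where "0 \<le> C"
    "\<And>v. norm v \<le> 1 \<Longrightarrow> \<bar>poly_eval p (s + v) - poly_eval p s - differential p s v\<bar> \<le> C * (norm v)\<^sup>2"
proof -
  obtain f' C where f': "(poly_eval p has_derivative f') (at s)" and C: "0 \<le> C"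
    "\<forall>v. norm v \<le> 1 \<longrightarrow> \<bar>poly_eval p (s + v) - poly_eval p s - f' v\<bar> \<le> C * (norm v)\<^sup>2"
    using quadratic_taylor_bound[OF real_polynomial_function_poly_eval[of p], of s] by blast
  have "f' = differential p s" using f' by (rule frechet_derivative_at)
  with C show thesis by (intro that) auto
qed

section \<open>Counting dimensions\<close>

text \<open>
  A single vector outside the kernel of \<open>f\<close>, added to a basis of the kernel, spans \<open>V\<close>.
\<close>

lemma dim_le_Suc_dim_kernel:
  fixes V :: "'a::real_vector set"
  assumes "subspace V" "finite T" "V \<subseteq> span T" and f: "linear (f :: 'a \<Rightarrow> real)"
  shows "dim V \<le> dim {x \<in> V. f x = 0} + 1"
proof (cases "\<forall>x\<in>V. f x = 0")
  case True
  then have "{x \<in> V. f x = 0} = V" by auto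
  then show ?thesis by simp
next
  case False
  then obtain u where u: "u \<in> V" "f u \<noteq> 0" by auto
  obtain B where B: "B \<subseteq> {x \<in> V. f x = 0}" "independent B" "{x \<in> V. f x = 0} \<subseteq> span B"
    "card B = dim {x \<in> V. f x = 0}"
    using real_vector.basis_exists by blast
  have "finite B"
    using real_vector.independent_span_bound[OF assms(2) B(2)] B(1) assms(3) by auto
  moreover have "V \<subseteq> span (insert u B)"
  proof
    fix x assume "x \<in> V"
    then have "x - (f x / f u) *\<^sub>R u \<in> {x \<in> V. f x = 0}"
      using u assms(1)
      by (simp add: subspace_diff subspace_scale linear_diff[OF f] linear_scale[OF f])
    then show "x \<in> span (insert u B)"
      using B(3) by (auto simp: real_vector.span_breakdown_eq)
  qed
  ultimately have "dim V \<le> card (insert u B)"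
    by (intro real_vector.dim_le_card) auto
  also have "\<dots> \<le> card B + 1"
    by (simp add: \<open>finite B\<close> card_insert_if)
  finally show ?thesis using B(4) by simp
qed

lemma dim_le_dim_common_kernel:
  fixes V :: "'a::real_vector set" and f :: "'i \<Rightarrow> 'a \<Rightarrow> real"
  assumes "subspace V" "finite T" "V \<subseteq> span T" and f: "\<And>i. linear (f i)" and "finite I"
  shows "dim V \<le> dim {x \<in> V. \<forall>i\<in>I. f i x = 0} + card I"
  using \<open>finite I\<close>
proof induction
  case empty
  then show ?case by simp
next
  case (insert i I)
  let ?W = "{x \<in> V. \<forall>i\<in>I. f i x = 0}"
  have "subspace ?W"
    using assms(1) by (auto simp: subspace_def linear_add[OF f] linear_scale[OF f] linear_0[OF f])
  then have "dim ?W \<le> dim {x \<in> ?W. f i x = 0} + 1"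
    using assms by (intro dim_le_Suc_dim_kernel[where T = T]) auto
  moreover have "{x \<in> ?W. f i x = 0} = {x \<in> V. \<forall>i\<in>insert i I. f i x = 0}" by auto
  ultimately show ?case using insert by simp
qed

text \<open>
  Here the codimension condition enters. A basis of the whole space that contains both \<open>v\<close>
  and \<open>s\<close> turns double vanishing at \<open>s\<close> into \<open>n\<close> linear conditions, of which those for
  \<open>s\<close> (by Euler's identity) and \<open>v\<close> hold on all of \<open>I1 d S\<close>. The other \<open>n - 2\<close>,
  together with the \<open>card S\<close> conditions that define \<open>I1 d S\<close>, are one too few for the
  required codimension.
\<close>

lemma common_tangent_is_radial:
  fixes S :: "(real ^ 'n::finite) set"
  assumes d: "1 \<le> d" and S: "finite_proj_set S" and ind: "d_independent d S" and s: "s \<in> S"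
    and v: "\<And>p. p \<in> I1 d S \<Longrightarrow> differential p s v = 0"
  shows "v \<in> span {s}"
proof (rule ccontr)
  assume nv: "v \<notin> span {s}"
  let ?F = "forms d :: 'n real_mpoly set"
  let ?W = "{p \<in> ?F. double_vanishes p s \<and> (\<forall>t\<in>S - {s}. poly_eval p t = 0)}"
  obtain T where T: "finite T" "?F \<subseteq> span T"
    by (rule forms_finite_dimensional)
  have "s \<noteq> 0" using S s by (auto simp: finite_proj_set_def)
  then have ind_vs: "independent {v, s}"
    using nv independent_insertI[of v "{s}"] by simp
  have "v \<noteq> s" using nv span_base[of s "{s}"] by blast
  obtain B where B: "{v, s} \<subseteq> B" "independent B" "span B = UNIV"
  proof (rule real_vector.maximal_independent_subset_extend[OF subset_UNIV ind_vs])
    fix B assume "{v, s} \<subseteq> B" "independent B" "UNIV \<subseteq> span B"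
    then show thesis by (intro that) blast+
  qed
  then have cB: "card B = CARD('n)"
    using real_vector.basis_card_eq_dim[of B UNIV] by simp
  have fB: "finite B" using B(2) by (rule independent_imp_finite)
  have "card {v, s} \<le> card B" using B(1) fB by (rule card_mono[rotated])
  then have n2: "2 \<le> CARD('n)" using \<open>v \<noteq> s\<close> cB by simp
  have "card (B - {v, s}) = card B - card {v, s}"
    using B(1) by (intro card_Diff_subset) auto
  then have cB': "card (B - {v, s}) = CARD('n) - 2"
    using \<open>v \<noteq> s\<close> cB by simp
  \<comment> \<open>The space \<open>?W\<close> asks for vanishing at the points of \<open>S\<close> other than \<open>s\<close> only;
    vanishing at \<open>s\<close> follows from double vanishing because \<open>d\<close> is positive.\<close>
  have "{p \<in> I1 d S. \<forall>w\<in>B - {v, s}. differential p s w = 0} = ?W"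
    (is "?K = _")
  proof (intro equalityI subsetI)
    fix p assume p: "p \<in> ?K"
    then have "differential p s s = 0"
      using s Euler_identity[of p d s] by (auto simp: I1_def)
    then have "double_vanishes p s"
      using p v by (auto simp: double_vanishes_iff_on_spanning_set[OF B(3)])
    then show "p \<in> ?W" using p by (auto simp: I1_def)
  next
    fix p assume p: "p \<in> ?W"
    then have "poly_eval p s = 0"
      using d double_vanishes_imp_vanishes by blast
    then show "p \<in> ?K" using p by (auto simp: I1_def double_vanishes_iff)
  qed
  moreover have "dim (I1 d S) \<le> dim ?K + card (B - {v, s})"
    using T fB
    by (intro dim_le_dim_common_kernel[where T = T] subspace_I1 linear_differential_form)
      (auto simp: I1_def)
  moreover have "dim ?F \<le> dim (I1 d S) + card S"
    unfolding I1_def using T S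
    by (intro dim_le_dim_common_kernel[where T = T] subspace_forms linear_poly_eval)
      (auto simp: finite_proj_set_def)
  moreover have "dim ?W + (card S + CARD('n) - 1) = dim ?F"
    using ind s by (simp add: d_independent_def)
  ultimately show False using cB' n2 by simp
qed

section \<open>Sums of squares dominate doubly vanishing forms\<close>

text \<open>
  The sum of squares has a positive minimum on the unit sphere of \<open>U\<close>, and it is homogeneous
  of degree two.
\<close>

lemma sum_squares_coercive_on_subspace:
  fixes L :: "'i \<Rightarrow> 'a::euclidean_space \<Rightarrow> real"
  assumes "finite I" and L: "\<And>i. linear (L i)" and U: "subspace U"
    and inj: "\<And>v. v \<in> U \<Longrightarrow> (\<And>i. i \<in> I \<Longrightarrow> L i v = 0) \<Longrightarrow> v = 0"
  obtains m where "0 < m" "\<And>v. v \<in> U \<Longrightarrow> m * (norm v)\<^sup>2 \<le> (\<Sum>i\<in>I. (L i v)\<^sup>2)"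
proof -
  let ?Q = "\<lambda>v. \<Sum>i\<in>I. (L i v)\<^sup>2"
  let ?K = "sphere 0 1 \<inter> U"
  have K: "compact ?K"
    using U by (intro compact_Int_closed compact_sphere closed_subspace)
  have cont: "continuous_on ?K ?Q"
    by (intro continuous_intros linear_continuous_on linear_conv_bounded_linear[THEN iffD1] L)
  have pos: "0 < ?Q v" if v: "v \<in> ?K" for v
  proof -
    have "v \<noteq> 0" using v by auto
    then obtain i where "i \<in> I" "L i v \<noteq> 0"
      using inj[of v] v by blast
    then show ?thesis
      using \<open>finite I\<close> by (intro sum_pos2[where i = i]) auto
  qed
  have "\<exists>m>0. \<forall>u\<in>?K. m \<le> ?Q u"
  proof (cases "?K = {}")
    case True
    then show ?thesis by (intro exI[of _ 1]) auto
  next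
    case False
    then obtain u where "u \<in> ?K" "\<And>w. w \<in> ?K \<Longrightarrow> ?Q u \<le> ?Q w"
      using continuous_attains_inf[OF K False cont] by blast
    then show ?thesis using pos by blast
  qed
  then obtain m where m: "0 < m" "\<And>u. u \<in> ?K \<Longrightarrow> m \<le> ?Q u" by blast
  have "m * (norm v)\<^sup>2 \<le> ?Q v" if v: "v \<in> U" for v
  proof (cases "v = 0")
    case True
    then show ?thesis by (simp add: sum_nonneg)
  next
    case False
    have "(1 / norm v) *\<^sub>R v \<in> ?K"
      using False v U by (simp add: subspace_scale)
    then have "m \<le> ?Q ((1 / norm v) *\<^sub>R v)" by (rule m(2))
    also have "\<dots> = ?Q v / (norm v)\<^sup>2"
      by (simp add: linear_scale[OF L] power_divide sum_divide_distrib)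
    finally show ?thesis
      using False by (simp add: pos_le_divide_eq)
  qed
  with m(1) show thesis by (rule that)
qed

text \<open>The difference of the two sides is \<open>(a + 2b)\<^sup>2 / 2\<close>.\<close>

lemma square_add_ge: "(a + b)\<^sup>2 \<ge> a\<^sup>2 / 2 - b\<^sup>2" for a b :: real
proof -
  have "(a + b)\<^sup>2 - (a\<^sup>2 / 2 - b\<^sup>2) = (a + 2 * b)\<^sup>2 / 2"
    by (simp add: power2_eq_square field_simps)
  then show ?thesis by (smt (verit) zero_le_power2 divide_nonneg_pos)
qed

text \<open>
  Writing each \<open>b(s + v)\<close> as its differential plus a remainder of size \<open>\<bar>v\<bar>\<^sup>2\<close>, the
  sum of squares is at least half the sum of the squared differentials, which is quadratic
  and coercive on \<open>U\<close>, minus a term of order four; the form \<open>q\<close> consists of its quadratic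
  remainder alone.
\<close>

lemma sum_squares_dominates_near_zero:
  fixes s :: "real ^ 'n::finite"
  assumes "finite B" and "subspace U"
    and van: "\<And>b. b \<in> B \<Longrightarrow> poly_eval b s = 0"
    and inj: "\<And>v. v \<in> U \<Longrightarrow> (\<And>b. b \<in> B \<Longrightarrow> differential b s v = 0) \<Longrightarrow> v = 0"
    and q: "poly_eval q s = 0" "double_vanishes q s"
  obtains \<epsilon> \<delta> where "0 < \<epsilon>" "0 < \<delta>"
    "\<And>v. v \<in> U \<Longrightarrow> norm v < \<delta> \<Longrightarrow>
      \<epsilon> * \<bar>poly_eval q (s + v)\<bar> \<le> (\<Sum>b\<in>B. (poly_eval b (s + v))\<^sup>2)"
proof -
  obtain m where m: "0 < m"
    "\<And>v. v \<in> U \<Longrightarrow> m * (norm v)\<^sup>2 \<le> (\<Sum>b\<in>B. (differential b s v)\<^sup>2)"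
    using sum_squares_coercive_on_subspace[OF assms(1), of "\<lambda>b. differential b s" U]
      linear_differential assms(2) inj by blast
  have "\<forall>p. \<exists>C\<ge>0. \<forall>v. norm v \<le> 1 \<longrightarrow>
      \<bar>poly_eval p (s + v) - poly_eval p s - differential p s v\<bar> \<le> C * (norm v)\<^sup>2"
    using poly_eval_taylor by metis
  then obtain C where C: "\<And>p. 0 \<le> C p" "\<And>p v. norm v \<le> 1 \<Longrightarrow>
      \<bar>poly_eval p (s + v) - poly_eval p s - differential p s v\<bar> \<le> C p * (norm v)\<^sup>2"
    by metis
  define A where "A = (\<Sum>b\<in>B. (C b)\<^sup>2)"
  have A: "0 \<le> A" by (simp add: A_def sum_nonneg)
  \<comment> \<open>For \<open>norm v < \<delta>\<close> the quartic error \<open>A * norm v ^ 4\<close> eats up at most half of the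
    quadratic lower bound \<open>m / 2 * norm v ^ 2\<close>; the summands \<open>1\<close> in the denominators
    only keep them positive.\<close>
  define \<delta> where "\<delta> = min 1 (sqrt (m / (4 * (A + 1))))"
  define \<epsilon> where "\<epsilon> = m / (4 * (C q + 1))"
  have \<delta>: "0 < \<delta>" using m(1) A by (simp add: \<delta>_def)
  have \<epsilon>: "0 < \<epsilon>" using m(1) C(1)[of q] by (simp add: \<epsilon>_def)
  have "\<epsilon> * \<bar>poly_eval q (s + v)\<bar> \<le> (\<Sum>b\<in>B. (poly_eval b (s + v))\<^sup>2)"
    if v: "v \<in> U" "norm v < \<delta>" for v
  proof -
    have v1: "norm v \<le> 1" using v by (simp add: \<delta>_def)
    have "(norm v)\<^sup>2 \<le> (sqrt (m / (4 * (A + 1))))\<^sup>2"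
      using v by (intro power_mono) (auto simp: \<delta>_def)
    also have "\<dots> = m / (4 * (A + 1))"
      using m(1) A by simp
    finally have "(norm v)\<^sup>2 * (4 * (A + 1)) \<le> m"
      using A by (simp add: pos_le_divide_eq)
    moreover have "(norm v)\<^sup>2 * (4 * (A + 1)) = 4 * (A * (norm v)\<^sup>2) + 4 * (norm v)\<^sup>2"
      by (simp add: algebra_simps)
    ultimately have small: "A * (norm v)\<^sup>2 \<le> m / 4"
      using zero_le_power2[of "norm v"] by linarith
    have "(poly_eval b (s + v))\<^sup>2 \<ge> (differential b s v)\<^sup>2 / 2 - (C b)\<^sup>2 * (norm v)^4"
      if b: "b \<in> B" for b
    proof -
      define R where "R = poly_eval b (s + v) - differential b s v"
      have "\<bar>R\<bar> \<le> C b * (norm v)\<^sup>2"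
        using C(2)[OF v1, of b] van[OF b] by (simp add: R_def)
      then have "R\<^sup>2 \<le> (C b * (norm v)\<^sup>2)\<^sup>2"
        by (metis abs_ge_zero power2_abs power_mono)
      then have "R\<^sup>2 \<le> (C b)\<^sup>2 * (norm v)^4"
        by (simp add: power_mult_distrib flip: power_mult)
      moreover have "poly_eval b (s + v) = differential b s v + R" by (simp add: R_def)
      ultimately show ?thesis using square_add_ge[of "differential b s v" R] by simp
    qed
    then have "(\<Sum>b\<in>B. (poly_eval b (s + v))\<^sup>2)
        \<ge> (\<Sum>b\<in>B. (differential b s v)\<^sup>2 / 2 - (C b)\<^sup>2 * (norm v)^4)"
      by (rule sum_mono)
    moreover have "(\<Sum>b\<in>B. (differential b s v)\<^sup>2 / 2 - (C b)\<^sup>2 * (norm v)^4)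
        = (\<Sum>b\<in>B. (differential b s v)\<^sup>2) / 2 - A * (norm v)^4"
      by (simp add: sum_subtractf A_def sum_distrib_right sum_divide_distrib)
    moreover have "A * (norm v)^4 \<le> m / 4 * (norm v)\<^sup>2"
      using mult_right_mono[OF small, of "(norm v)\<^sup>2"]
      by (simp add: mult.assoc flip: power_add)
    ultimately have "m / 4 * (norm v)\<^sup>2 \<le> (\<Sum>b\<in>B. (poly_eval b (s + v))\<^sup>2)"
      using m(2)[OF v(1)] by simp
    moreover have "\<epsilon> * \<bar>poly_eval q (s + v)\<bar> \<le> m / 4 * (norm v)\<^sup>2"
    proof -
      have "\<bar>poly_eval q (s + v)\<bar> \<le> C q * (norm v)\<^sup>2"
        using C(2)[OF v1, of q] q by (simp add: double_vanishes_iff)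
      then have "\<epsilon> * \<bar>poly_eval q (s + v)\<bar> \<le> \<epsilon> * (C q * (norm v)\<^sup>2)"
        using \<epsilon> by simp
      also have "\<dots> = (\<epsilon> * C q) * (norm v)\<^sup>2" by simp
      also have "\<dots> \<le> m / 4 * (norm v)\<^sup>2"
        using C(1)[of q] m(1) by (intro mult_right_mono) (auto simp: \<epsilon>_def field_simps)
      finally show ?thesis .
    qed
    ultimately show ?thesis by linarith
  qed
  with \<epsilon> \<delta> show thesis by (rule that)
qed

text \<open>
  Take the least \<open>\<epsilon>\<close> of a finite subcover; shrinking \<open>\<epsilon>\<close> is harmless because
  \<open>g\<close> enters through its absolute value.
\<close>

lemma compact_uniform_domination:
  fixes f g :: "'a::topological_space \<Rightarrow> real"
  assumes K: "compact K"
    and loc: "\<And>x. x \<in> K \<Longrightarrow>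
      \<exists>U \<epsilon>. open U \<and> x \<in> U \<and> 0 < \<epsilon> \<and> (\<forall>y\<in>U. \<epsilon> * \<bar>g y\<bar> \<le> f y)"
  shows "\<exists>\<epsilon>>0. \<forall>y\<in>K. \<epsilon> * \<bar>g y\<bar> \<le> f y"
proof -
  obtain U \<epsilon> where U: "\<And>x. x \<in> K \<Longrightarrow> open (U x) \<and> x \<in> U x \<and> 0 < \<epsilon> x
      \<and> (\<forall>y\<in>U x. \<epsilon> x * \<bar>g y\<bar> \<le> f y)"
    using loc by metis
  obtain F where F: "F \<subseteq> K" "finite F" "K \<subseteq> (\<Union>x\<in>F. U x)"
    by (rule compactE_image[OF K, of K U]) (use U in blast)+
  define e where "e = Min (insert 1 (\<epsilon> ` F))"
  have "0 < e" using F U by (auto simp: e_def)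
  moreover have "e * \<bar>g y\<bar> \<le> f y" if y: "y \<in> K" for y
  proof -
    obtain x where x: "x \<in> F" "y \<in> U x" using F y by blast
    have "e \<le> \<epsilon> x" using x F by (simp add: e_def)
    then have "e * \<bar>g y\<bar> \<le> \<epsilon> x * \<bar>g y\<bar>" by (intro mult_right_mono) auto
    also have "\<dots> \<le> f y" using U x F by blast
    finally show ?thesis .
  qed
  ultimately show ?thesis by blast
qed

text \<open>
  A point \<open>y\<close> with \<open>s \<bullet> y \<noteq> 0\<close> is a multiple \<open>t (s + v)\<close> of a point of the affine
  hyperplane through \<open>s\<close> orthogonal to \<open>s\<close>, and \<open>v\<close> depends continuously on \<open>y\<close> and is
  zero on the line through \<open>s\<close>. Both forms have the same even degree, so the inequality at
  \<open>s + v\<close> gives the one at \<open>y\<close>, also for negative \<open>t\<close>.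
\<close>

lemma domination_near_line:
  fixes s :: "real ^ 'n::finite"
  assumes p: "p \<in> forms (2 * d)" and q: "q \<in> forms (2 * d)" and s: "s \<noteq> 0" and x: "proj_eq x s"
    and dom: "\<And>v. s \<bullet> v = 0 \<Longrightarrow> norm v < \<delta> \<Longrightarrow>
      \<epsilon> * \<bar>poly_eval q (s + v)\<bar> \<le> poly_eval p (s + v)"
    and "0 < \<delta>"
  shows "\<exists>U. open U \<and> x \<in> U \<and> (\<forall>y\<in>U. \<epsilon> * \<bar>poly_eval q y\<bar> \<le> poly_eval p y)"
proof -
  define t where "t y = (s \<bullet> y) / (s \<bullet> s)" for y
  let ?N = "{y. s \<bullet> y \<noteq> 0}"
  let ?h = "\<lambda>y. norm ((1 / t y) *\<^sub>R y - s)"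
  let ?U = "?N \<inter> ?h -` {..<\<delta>}"
  have N: "open ?N"
    by (intro open_Collect_neq continuous_intros)
  have "continuous_on ?N ?h"
    unfolding t_def using s by (intro continuous_intros) auto
  then have "open ?U"
    using N open_lessThan by (rule continuous_open_preimage)
  moreover obtain c where c: "c \<noteq> 0" "x = c *\<^sub>R s"
    using x by (auto simp: proj_eq_def)
  then have "x \<in> ?U"
    using s \<open>0 < \<delta>\<close> by (simp add: t_def)
  moreover have "\<epsilon> * \<bar>poly_eval q y\<bar> \<le> poly_eval p y" if y: "y \<in> ?U" for y
  proof -
    define v where "v = (1 / t y) *\<^sub>R y - s"
    have t: "t y \<noteq> 0" using y s by (simp add: t_def)
    have "s \<bullet> v = 0"
      using y s by (simp add: v_def t_def inner_diff_right)
    then have *: "\<epsilon> * \<bar>poly_eval q (s + v)\<bar> \<le> poly_eval p (s + v)"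
      using y by (intro dom) (auto simp: v_def)
    have yv: "y = t y *\<^sub>R (s + v)" using t by (simp add: v_def)
    have t0: "0 \<le> t y ^ (2 * d)" by (simp add: power_mult)
    have "\<epsilon> * \<bar>poly_eval q y\<bar> = t y ^ (2 * d) * (\<epsilon> * \<bar>poly_eval q (s + v)\<bar>)"
      using t0 by (subst yv) (simp add: poly_eval_homogeneous[OF q] abs_mult)
    also have "\<dots> \<le> t y ^ (2 * d) * poly_eval p (s + v)"
      using * t0 by (rule mult_left_mono)
    also have "\<dots> = poly_eval p y"
      by (subst (2) yv) (simp add: poly_eval_homogeneous[OF p])
    finally show ?thesis .
  qed
  ultimately show ?thesis by blast
qed

lemma homogeneous_domination_from_sphere:
  assumes p: "p \<in> forms (2 * d)" and q: "q \<in> forms (2 * d)" and d: "1 \<le> d"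
    and dom: "\<And>y. y \<in> sphere 0 1 \<Longrightarrow> \<epsilon> * \<bar>poly_eval q y\<bar> \<le> poly_eval p y"
  shows "\<epsilon> * \<bar>poly_eval q x\<bar> \<le> poly_eval p x"
proof (cases "x = 0")
  case True
  then show ?thesis
    using poly_eval_homogeneous[OF p, of 0 0] poly_eval_homogeneous[OF q, of 0 0] d
    by (simp add: power_0_left)
next
  case False
  define u where "u = (1 / norm x) *\<^sub>R x"
  have x: "x = norm x *\<^sub>R u" and u: "u \<in> sphere 0 1" using False by (auto simp: u_def)
  have n: "0 \<le> norm x ^ (2 * d)" by simp
  have "\<epsilon> * \<bar>poly_eval q (norm x *\<^sub>R u)\<bar> = norm x ^ (2 * d) * (\<epsilon> * \<bar>poly_eval q u\<bar>)"
    using n by (simp add: poly_eval_homogeneous[OF q] abs_mult)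
  also have "\<dots> \<le> norm x ^ (2 * d) * poly_eval p u"
    using dom[OF u] n by (rule mult_left_mono)
  also have "\<dots> = poly_eval p (norm x *\<^sub>R u)"
    by (simp add: poly_eval_homogeneous[OF p])
  finally show ?thesis using x by simp
qed

lemma I1_finite_generating_set:
  fixes S :: "(real ^ 'n::finite) set"
  obtains B where "finite B" "B \<subseteq> I1 d S" "I1 d S \<subseteq> span B"
proof -
  obtain T :: "'n real_mpoly set" where T: "finite T" "forms d \<subseteq> span T"
    by (rule forms_finite_dimensional)
  obtain B where B: "B \<subseteq> I1 d S" "independent B" "I1 d S \<subseteq> span B"
    by (rule real_vector.basis_exists)
  have "B \<subseteq> span T" using B(1) T(2) by (auto simp: I1_def)
  then have "finite B" using real_vector.independent_span_bound[OF T(1) B(2)] by blast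
  then show thesis using B(1,3) by (rule that)
qed

text \<open>
  The conclusion says that \<open>p\<close> is an algebraic interior point of the cone
  \<open>Pos_face (2 * d) S\<close> relative to \<open>I2 (2 * d) S\<close>.
\<close>

lemma interior_form_exists:
  fixes S :: "(real ^ 'n::finite) set"
  assumes d: "1 \<le> d" and S: "finite_proj_set S" and ind: "d_independent d S"
  shows "\<exists>p\<in>Pos_face (2 * d) S. \<forall>q\<in>I2 (2 * d) S.
    \<exists>\<epsilon>>0. \<forall>x. \<epsilon> * \<bar>poly_eval q x\<bar> \<le> poly_eval p x"
proof -
  obtain B where B: "finite B" "B \<subseteq> I1 d S" "I1 d S \<subseteq> span B"
    by (rule I1_finite_generating_set)
  define p where "p = (\<Sum>b\<in>B. b * b)"
  have eval_p: "poly_eval p x = (\<Sum>b\<in>B. (poly_eval b x)\<^sup>2)" for x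
    by (simp add: p_def poly_eval_sum poly_eval_mult power2_eq_square)
  have p_nonneg: "0 \<le> poly_eval p x" for x
    by (simp add: eval_p sum_nonneg)
  have "b * b \<in> forms (2 * d)" if "b \<in> B" for b
    using forms_mult[of b d b d] that B(2) by (auto simp: I1_def mult_2)
  then have p_form: "p \<in> forms (2 * d)"
    unfolding p_def by (intro subspace_sum subspace_forms)
  have vanS: "poly_eval b s = 0" if "b \<in> B" "s \<in> S" for b s
    using that B(2) by (auto simp: I1_def)
  have p_face: "p \<in> Pos_face (2 * d) S"
    using p_form p_nonneg vanS by (simp add: Pos_face_def Pos_def eval_p)
  \<comment> \<open>The first condition of \<open>d\<close>-independence: no zeros besides \<open>S\<close>.\<close>
  have zeros: "\<exists>s\<in>S. proj_eq x s" if "x \<noteq> 0" "poly_eval p x = 0" for x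
  proof -
    have "\<forall>b\<in>B. poly_eval b x = 0"
      using that(2) B(1) by (simp add: eval_p sum_nonneg_eq_0_iff)
    then have "poly_eval r x = 0" if "r \<in> I1 d S" for r
      using linear_eq_0_on_span[OF linear_poly_eval, of B x r] that B(3) by blast
    then show ?thesis
      using ind that(1) unfolding d_independent_def by blast
  qed
  \<comment> \<open>The second condition: no tangent direction transversal to the line of \<open>s\<close> is lost.\<close>
  have inj: "v = 0" if s: "s \<in> S" and v: "s \<bullet> v = 0" and db: "\<And>b. b \<in> B \<Longrightarrow> differential b s v = 0"
    for s v
  proof -
    have "differential r s v = 0" if "r \<in> I1 d S" for r
      using linear_eq_0_on_span[OF linear_differential_form, of B s v r] db that B(3) by blast
    then have "v \<in> span {s}"
      by (rule common_tangent_is_radial[OF d S ind s])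
    then obtain k where "v = k *\<^sub>R s" by (auto simp: span_singleton)
    then show ?thesis using v by auto
  qed
  have "\<exists>\<epsilon>>0. \<forall>x. \<epsilon> * \<bar>poly_eval q x\<bar> \<le> poly_eval p x" if q: "q \<in> I2 (2 * d) S" for q
  proof -
    have q_form: "q \<in> forms (2 * d)" using q by (simp add: I2_def)
    have loc: "\<exists>U \<epsilon>. open U \<and> x \<in> U \<and> 0 < \<epsilon> \<and> (\<forall>y\<in>U. \<epsilon> * \<bar>poly_eval q y\<bar> \<le> poly_eval p y)"
      if x: "x \<in> sphere 0 1" for x
    proof (cases "poly_eval p x = 0")
      case True
      moreover have "x \<noteq> 0" using x by auto
      ultimately obtain s where s: "s \<in> S" "proj_eq x s" using zeros by blast
      have s0: "s \<noteq> 0" using s S by (auto simp: finite_proj_set_def)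
      have qs: "double_vanishes q s" using q s by (simp add: I2_def)
      have qs0: "poly_eval q s = 0"
        using double_vanishes_imp_vanishes[OF q_form _ qs] d by simp
      obtain \<epsilon> \<delta> where \<epsilon>: "0 < \<epsilon>" "0 < \<delta>" and dom: "\<And>v. v \<in> {v. s \<bullet> v = 0} \<Longrightarrow> norm v < \<delta> \<Longrightarrow>
          \<epsilon> * \<bar>poly_eval q (s + v)\<bar> \<le> (\<Sum>b\<in>B. (poly_eval b (s + v))\<^sup>2)"
        by (rule sum_squares_dominates_near_zero[OF B(1) subspace_hyperplane, of s s q])
          (use vanS inj s qs qs0 in auto)
      have "\<exists>U. open U \<and> x \<in> U \<and> (\<forall>y\<in>U. \<epsilon> * \<bar>poly_eval q y\<bar> \<le> poly_eval p y)"
        using dom by (intro domination_near_line[OF p_form q_form s0 s(2) _ \<epsilon>(2)]) (simp add: eval_p)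
      with \<epsilon>(1) show ?thesis by blast
    next
      case False
      then have px: "0 < poly_eval p x" using p_nonneg[of x] by simp
      \<comment> \<open>Chosen to make the inequality strict at \<open>x\<close>, so that it persists nearby.\<close>
      define \<epsilon> where "\<epsilon> = poly_eval p x / (2 * (\<bar>poly_eval q x\<bar> + 1))"
      have \<epsilon>: "0 < \<epsilon>" using px by (simp add: \<epsilon>_def)
      have "\<epsilon> * \<bar>poly_eval q x\<bar> < poly_eval p x"
        using px by (simp add: \<epsilon>_def field_simps add_strict_increasing)
      moreover have "open {y. \<epsilon> * \<bar>poly_eval q y\<bar> < poly_eval p y}"
        by (intro open_Collect_less continuous_intros continuous_on_poly_eval)
      ultimately show ?thesis
        using \<epsilon> by (intro exI[of _ "{y. \<epsilon> * \<bar>poly_eval q y\<bar> < poly_eval p y}"] exI[of _ \<epsilon>]) auto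
    qed
    obtain \<epsilon> where "0 < \<epsilon>" and \<epsilon>: "\<forall>y\<in>sphere 0 1. \<epsilon> * \<bar>poly_eval q y\<bar> \<le> poly_eval p y"
      using compact_uniform_domination[OF compact_sphere loc] by blast
    have "\<epsilon> * \<bar>poly_eval q x\<bar> \<le> poly_eval p x" for x
      by (rule homogeneous_domination_from_sphere[OF p_form q_form d]) (rule \<epsilon>[rule_format])
    with \<open>0 < \<epsilon>\<close> show ?thesis by (intro exI[of _ \<epsilon>] conjI allI)
  qed
  then show ?thesis by (intro bexI[OF _ p_face] ballI)
qed

lemma Pos_face_subset_I2: "Pos_face m S \<subseteq> I2 m S"
proof
  fix p assume p: "p \<in> Pos_face m S"
  have "differential p s = (\<lambda>v. 0)" if "s \<in> S" for s
    using p that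
    by (intro differential_zero_maxmin[OF UNIV_I open_UNIV has_derivative_differential])
      (auto simp: Pos_face_def Pos_def)
  then show "p \<in> I2 m S"
    using p by (simp add: I2_def Pos_face_def Pos_def double_vanishes_iff)
qed

theorem corollary3p5:
  fixes S :: "(real ^ 'n::finite) set" and d :: nat
  assumes "1 \<le> d"
    and "finite_proj_set S"
    and "d_independent d S"
  shows "span (Pos_face (2 * d) S) = I2 (2 * d) S"
proof
  show "span (Pos_face (2 * d) S) \<subseteq> I2 (2 * d) S"
    by (intro span_minimal Pos_face_subset_I2 subspace_I2)
  obtain p where p: "p \<in> Pos_face (2 * d) S"
    and dom: "\<forall>q\<in>I2 (2 * d) S. \<exists>\<epsilon>>0. \<forall>x. \<epsilon> * \<bar>poly_eval q x\<bar> \<le> poly_eval p x"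
    using interior_form_exists[OF assms] by (rule bexE)
  show "I2 (2 * d) S \<subseteq> span (Pos_face (2 * d) S)"
  proof
    fix q assume q: "q \<in> I2 (2 * d) S"
    then obtain \<epsilon> where \<epsilon>: "0 < \<epsilon>" "\<And>x. \<epsilon> * \<bar>poly_eval q x\<bar> \<le> poly_eval p x"
      using bspec[OF dom q] by auto
    have "0 \<le> poly_eval (p + \<epsilon> *\<^sub>R q) x" for x
    proof -
      have "\<epsilon> * - \<bar>poly_eval q x\<bar> \<le> \<epsilon> * poly_eval q x"
        using \<epsilon>(1) by (intro mult_left_mono) auto
      then show ?thesis
        using \<epsilon>(2)[of x] by (simp add: poly_eval_add poly_eval_scaleR)
    qed
    moreover have "p + \<epsilon> *\<^sub>R q \<in> forms (2 * d)"
      using p q by (auto simp: Pos_face_def Pos_def I2_def intro: subspace_add subspace_scale subspace_forms)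
    moreover have "poly_eval (p + \<epsilon> *\<^sub>R q) s = 0" if "s \<in> S" for s
    proof -
      have "poly_eval q s = 0"
        using q that assms(1) by (intro double_vanishes_imp_vanishes[of q "2 * d"]) (auto simp: I2_def)
      then show ?thesis
        using p that by (simp add: Pos_face_def poly_eval_add poly_eval_scaleR)
    qed
    ultimately have "p + \<epsilon> *\<^sub>R q \<in> Pos_face (2 * d) S"
      by (simp add: Pos_face_def Pos_def)
    then have "(1 / \<epsilon>) *\<^sub>R ((p + \<epsilon> *\<^sub>R q) - p) \<in> span (Pos_face (2 * d) S)"
      using p by (intro span_scale span_diff span_base)
    then show "q \<in> span (Pos_face (2 * d) S)"
      using \<epsilon>(1) by simp
  qed
qed

end
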